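(* For any infinite abelian group $G$, $S_G(2)=3$.
   Context: For $A\subset G$ and a positive integer $h$, $hA$ is the set of sums of $h$ not necessarily distinct elements of $A$; $A\sim B$ means finite symmetric difference. $\operatorname{ord}^*_G(A)$ is the least $k$ with $kA\sim G$ ($\infty$ if none). $S_G(h)$ is the minimum value of $s$ such that for every $A\subset G$ with $hA\sim G$, there are only finitely many $a\in A$ with $\operatorname{ord}^*_G(A\setminus\{a\})>s$ (and $S_G(h)=\infty$ if no such $s$ exists). *)

theory Defs
  imports Main "HOL-Library.Extended_Nat"
begin

definition hfold_sum :: "nat \<Rightarrow> 'a::ab_group_add set \<Rightarrow> 'a set" where
  "hfold_sum h A = {sum_list xs | xs. length xs = h \<and> set xs \<subseteq> A}"

definition almost_eq :: "'a set \<Rightarrow> 'a set \<Rightarrow> bool" (infix "\<sim>\<^sub>f" 50) where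
  "A \<sim>\<^sub>f B \<longleftrightarrow> finite (sym_diff A B)"

(* Sets of naturals are embedded in enat so that the infimum is the minimum,
   or \<infinity> for the empty set. *)
definition ord_star :: "'a::ab_group_add set \<Rightarrow> enat" where
  "ord_star A = Inf {enat k | k. 0 < k \<and> hfold_sum k A \<sim>\<^sub>f UNIV}"

(* The group is the whole type 'a, passed as a type argument. *)
definition S_fun :: "'a::ab_group_add itself \<Rightarrow> nat \<Rightarrow> enat" where
  "S_fun G h = Inf {enat s | s. \<forall>A :: 'a set. hfold_sum h A \<sim>\<^sub>f UNIV \<longrightarrow>
      finite {a \<in> A. ord_star (A - {a}) > enat s}}"

end

theory Submission
  imports Defs "HOL-Library.Countable_Set" "HOL-Library.Infinite_Set" "HOL-Library.Multiset"
    "HOL-Library.Set_Algebras" "HOL-Computational_Algebra.Group_Closure"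
begin

text \<open>
  Upper bound: let \<open>A + A \<sim> G\<close>, and let \<open>x\<close> lie outside \<open>3(A - {a})\<close>. For almost all \<open>c \<in> A\<close>, the element
  \<open>x - c\<close> is a sum of two elements of \<open>A\<close>, but only of \<open>a\<close> and another one; so \<open>x - a - c \<in> A\<close>. Two such
  \<open>x\<close> yield some \<open>\<delta> \<noteq> 0\<close> such that \<open>c + \<delta>\<close> and \<open>c - \<delta>\<close> are in \<open>A\<close> for almost all \<open>c \<in> A\<close>. Now let \<open>a \<in> A\<close>
  be any element for which some \<open>v\<close> lies outside \<open>3(A - {a})\<close>. If \<open>a + \<delta> \<in> A\<close>, then
  \<open>v = (a + \<delta>) + (c - \<delta>) + (v - a - c)\<close> for suitable \<open>c\<close> is a contradiction. So \<open>a\<close> is one of the finitely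
  many elements of \<open>A\<close> with \<open>a + \<delta> \<notin> A\<close>.

  Lower bound: take disjoint infinite countable sets \<open>P\<close>, \<open>Q\<close>, \<open>T\<close> with union \<open>D\<close> such that all relations
  between few elements of \<open>D\<close> are trivial. Given a finite set \<open>U\<close>, every \<open>z\<close> outside \<open>P + Q\<close> can be written
  as \<open>u + t\<close> with \<open>t \<in> T\<close> such that \<open>P + Q\<close> contains neither \<open>u + u\<close> nor a sum of \<open>u\<close> and an element of
  \<open>D \<union> U\<close>. A greedy choice of such \<open>u\<close> covers a given countable set. With \<open>K\<close> the subgroup generated by
  \<open>D\<close>, it is carried out separately for each countable set \<open>(x + K) \<union> (- x + K)\<close>: sums of elements from
  different such sets are not in \<open>K\<close>, let alone in \<open>P + Q\<close>. The union \<open>A\<close> of \<open>D\<close> and all chosen \<open>u\<close>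
  satisfies \<open>A + A = G\<close>, but \<open>p + q\<close> with \<open>p \<in> P\<close> and \<open>q \<in> Q\<close> is not in \<open>(A - {p}) + (A - {p})\<close>.
\<close>

section \<open>Sumsets and orders of bases\<close>

lemma hfold_sum_0: "hfold_sum 0 A = {0}"
  by (auto simp: hfold_sum_def)

lemma hfold_sum_Suc: "hfold_sum (Suc h) A = A + hfold_sum h A"
proof (intro equalityI subsetI)
  fix x assume "x \<in> hfold_sum (Suc h) A"
  then obtain a xs where "a \<in> A" "length xs = h" "set xs \<subseteq> A" "x = a + sum_list xs"
    by (auto simp: hfold_sum_def length_Suc_conv)
  then show "x \<in> A + hfold_sum h A"
    unfolding hfold_sum_def by blast
next
  fix x assume "x \<in> A + hfold_sum h A"
  then obtain a xs where "a \<in> A" "length xs = h" "set xs \<subseteq> A" "x = a + sum_list xs"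
    by (auto simp: set_plus_def hfold_sum_def)
  then show "x \<in> hfold_sum (Suc h) A"
    unfolding hfold_sum_def by (intro CollectI exI[of _ "a # xs"]) simp
qed

lemma hfold_sum_2: "hfold_sum 2 A = A + A"
  by (simp add: hfold_sum_Suc hfold_sum_0 numeral_2_eq_2)

lemma almost_eq_UNIV_iff_MOST: "A \<sim>\<^sub>f UNIV \<longleftrightarrow> (\<forall>\<^sub>\<infinity>x. x \<in> A)"
  by (simp add: almost_eq_def MOST_iff_cofinite Compl_eq_Diff_UNIV[symmetric] Compl_eq)

lemma MOST_diff_left:
  fixes x :: "'a::ab_group_add"
  shows "\<forall>\<^sub>\<infinity>c. P c \<Longrightarrow> \<forall>\<^sub>\<infinity>c. P (x - c)"
  by (rule MOST_inj) (auto intro: injI)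

lemma infinite_imp_ex_MOST:
  assumes "infinite A" and "\<forall>\<^sub>\<infinity>x. P x"
  shows "\<exists>x\<in>A. P x"
  using assms unfolding MOST_iff_cofinite by (metis (mono_tags) finite_subset mem_Collect_eq subsetI)

lemma MOST_avoidI:
  assumes "\<And>t. t \<in> T \<Longrightarrow> P t \<Longrightarrow> \<exists>F. finite F \<and> {s \<in> T. P s} \<subseteq> F"
  shows "\<forall>\<^sub>\<infinity>t. t \<in> T \<longrightarrow> \<not> P t"
proof -
  have "finite {t \<in> T. P t}"
    using assms by (cases "{t \<in> T. P t} = {}") (auto intro: finite_subset)
  then show ?thesis
    by (simp add: MOST_iff_cofinite)
qed

lemma infinite_of_hfold_sum_almost_UNIV:
  fixes A :: "'a::ab_group_add set"
  assumes "infinite (UNIV :: 'a set)" and "hfold_sum h A \<sim>\<^sub>f UNIV"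
  shows "infinite A"
proof
  assume "finite A"
  then have "finite (hfold_sum h A)"
    by (induction h) (simp_all add: hfold_sum_0 hfold_sum_Suc finite_set_plus)
  with assms show False
    by (simp add: almost_eq_def finite_Diff2)
qed

lemma hfold_sum_almost_UNIV_mono:
  fixes A :: "'a::ab_group_add set"
  assumes "infinite (UNIV :: 'a set)" and "k \<le> h" and "hfold_sum k A \<sim>\<^sub>f UNIV"
  shows "hfold_sum h A \<sim>\<^sub>f UNIV"
  using \<open>k \<le> h\<close>
proof (induction h rule: dec_induct)
  case (step n)
  obtain a where "a \<in> A"
    using infinite_of_hfold_sum_almost_UNIV[OF assms(1,3)] by fastforce
  have "\<forall>\<^sub>\<infinity>x. x - a \<in> hfold_sum n A"
    using MOST_inj[OF step.IH[unfolded almost_eq_UNIV_iff_MOST], of "\<lambda>x. x - a"] by (simp add: inj_def)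
  then have "\<forall>\<^sub>\<infinity>x. x \<in> hfold_sum (Suc n) A"
  proof eventually_elim
    case (elim x)
    with \<open>a \<in> A\<close> have "a + (x - a) \<in> hfold_sum (Suc n) A"
      unfolding hfold_sum_Suc by blast
    then show ?case by simp
  qed
  then show ?case by (simp add: almost_eq_UNIV_iff_MOST)
qed (fact assms)

lemma ord_star_le_iff:
  fixes A :: "'a::ab_group_add set"
  assumes "infinite (UNIV :: 'a set)" and "0 < h"
  shows "ord_star A \<le> enat h \<longleftrightarrow> hfold_sum h A \<sim>\<^sub>f UNIV"
proof
  assume "ord_star A \<le> enat h"
  then have "ord_star A < enat (Suc h)"
    by (rule le_less_trans) simp
  then obtain k where "k \<le> h" "hfold_sum k A \<sim>\<^sub>f UNIV"
    by (auto simp: ord_star_def Inf_less_iff less_Suc_eq_le)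
  then show "hfold_sum h A \<sim>\<^sub>f UNIV"
    using hfold_sum_almost_UNIV_mono assms(1) by blast
next
  assume "hfold_sum h A \<sim>\<^sub>f UNIV"
  then show "ord_star A \<le> enat h"
    unfolding ord_star_def using \<open>0 < h\<close> by (intro Inf_lower) blast
qed

definition essential_elements :: "nat \<Rightarrow> 'a::ab_group_add set \<Rightarrow> 'a set" where
  "essential_elements h A = {a \<in> A. \<not> hfold_sum h (A - {a}) \<sim>\<^sub>f UNIV}"

lemma S_fun_le_iff:
  assumes "infinite (UNIV :: 'a::ab_group_add set)" and "0 < s"
  shows "S_fun TYPE('a) h \<le> enat s \<longleftrightarrow>
    (\<forall>A :: 'a set. hfold_sum h A \<sim>\<^sub>f UNIV \<longrightarrow> finite (essential_elements s A))"
    (is "_ \<longleftrightarrow> ?finite")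
proof -
  have essential: "{a \<in> A. ord_star (A - {a}) > enat s} = essential_elements s A" for A :: "'a set"
    using ord_star_le_iff[OF assms] by (auto simp: essential_elements_def not_le[symmetric])
  show ?thesis
  proof
    assume "S_fun TYPE('a) h \<le> enat s"
    then have "S_fun TYPE('a) h < enat (Suc s)"
      by (rule le_less_trans) simp
    then obtain r where "enat r < enat (Suc s)"
      and r: "\<forall>A :: 'a set. hfold_sum h A \<sim>\<^sub>f UNIV \<longrightarrow> finite {a \<in> A. ord_star (A - {a}) > enat r}"
      unfolding S_fun_def Inf_less_iff by blast
    then have "r \<le> s" by simp
    have "essential_elements s A \<subseteq> {a \<in> A. ord_star (A - {a}) > enat r}" for A :: "'a set"
      using \<open>r \<le> s\<close> le_less_trans[of "enat r" "enat s"] by (auto simp flip: essential)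
    then show ?finite using r finite_subset by blast
  next
    assume ?finite
    then show "S_fun TYPE('a) h \<le> enat s"
      unfolding S_fun_def by (intro Inf_lower) (auto simp: essential)
  qed
qed


section \<open>Almost all elements are dispensable at order three\<close>

lemma hfold_sum_Suc_diff:
  assumes "y \<in> hfold_sum (Suc h) A" and "y \<notin> hfold_sum (Suc h) (A - {a})"
  shows "y - a \<in> hfold_sum h A"
proof -
  obtain xs where xs: "length xs = Suc h" "set xs \<subseteq> A" "y = sum_list xs"
    using assms(1) by (auto simp: hfold_sum_def)
  then have "a \<in> set xs"
    using assms(2) by (force simp: hfold_sum_def)
  then have "y - a = sum_list (remove1 a xs)"
    using sum_list_map_remove1[of a xs "\<lambda>x. x"] xs by simp
  moreover have "length (remove1 a xs) = h" "set (remove1 a xs) \<subseteq> A"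
    using xs \<open>a \<in> set xs\<close> set_remove1_subset[of a xs] by (auto simp: length_remove1)
  ultimately show ?thesis
    by (auto simp: hfold_sum_def)
qed

lemma MOST_reflection:
  fixes A :: "'a::ab_group_add set"
  assumes basis: "hfold_sum (Suc h) A \<sim>\<^sub>f UNIV" and x: "x \<notin> hfold_sum (Suc (Suc h)) (A - {a})"
  shows "\<forall>\<^sub>\<infinity>c. c \<in> A \<longrightarrow> x - a - c \<in> hfold_sum h A"
proof -
  have "\<forall>\<^sub>\<infinity>c. x - c \<in> hfold_sum (Suc h) A"
    using basis by (intro MOST_diff_left) (simp add: almost_eq_UNIV_iff_MOST)
  moreover have "\<forall>\<^sub>\<infinity>c. c \<noteq> a" by simp
  ultimately show ?thesis
  proof eventually_elim
    case (elim c)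
    show ?case
    proof
      assume "c \<in> A"
      have "x - c \<notin> hfold_sum (Suc h) (A - {a})"
      proof
        assume "x - c \<in> hfold_sum (Suc h) (A - {a})"
        then have "c + (x - c) \<in> hfold_sum (Suc (Suc h)) (A - {a})"
          using \<open>c \<in> A\<close> \<open>c \<noteq> a\<close> unfolding hfold_sum_Suc[of "Suc h"] by blast
        with x show False by simp
      qed
      then have "x - c - a \<in> hfold_sum h A"
        using hfold_sum_Suc_diff \<open>x - c \<in> hfold_sum (Suc h) A\<close> by blast
      then show "x - a - c \<in> hfold_sum h A"
        by (simp add: algebra_simps)
    qed
  qed
qed

lemma MOST_translation_of_reflections:
  fixes A :: "'a::ab_group_add set"
  assumes "\<forall>\<^sub>\<infinity>c. c \<in> A \<longrightarrow> y - c \<in> A" and "\<forall>\<^sub>\<infinity>c. c \<in> A \<longrightarrow> y' - c \<in> A"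
  shows "\<forall>\<^sub>\<infinity>c. c \<in> A \<longrightarrow> c + (y - y') \<in> A"
  using MOST_diff_left[OF assms(1), of y'] assms(2)
  by eventually_elim (simp add: algebra_simps)

lemma MOST_reflection_2:
  fixes A :: "'a::ab_group_add set"
  assumes "hfold_sum 2 A \<sim>\<^sub>f UNIV" and "x \<notin> hfold_sum 3 (A - {a})"
  shows "\<forall>\<^sub>\<infinity>c. c \<in> A \<longrightarrow> x - a - c \<in> A"
  using MOST_reflection[of 1 A x a] assms
  by (simp add: hfold_sum_Suc hfold_sum_0 numeral_2_eq_2 numeral_3_eq_3)

lemma almost_invariant_translation_exists:
  fixes A :: "'a::ab_group_add set"
  assumes basis: "hfold_sum 2 A \<sim>\<^sub>f UNIV" and "\<not> hfold_sum 3 (A - {a}) \<sim>\<^sub>f UNIV"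
  obtains \<delta> where "\<delta> \<noteq> 0" "\<forall>\<^sub>\<infinity>c. c \<in> A \<longrightarrow> c + \<delta> \<in> A" "\<forall>\<^sub>\<infinity>c. c \<in> A \<longrightarrow> c - \<delta> \<in> A"
proof -
  have missed: "\<exists>\<^sub>\<infinity>x. x \<notin> hfold_sum 3 (A - {a})"
    using assms(2) by (simp add: almost_eq_UNIV_iff_MOST)
  then obtain x where x: "x \<notin> hfold_sum 3 (A - {a})"
    by (rule INFM_E)
  obtain y where y: "y \<notin> hfold_sum 3 (A - {a})" "y \<noteq> x"
    using INFM_conjI[OF missed, of "\<lambda>y. y \<noteq> x"] by (auto elim: INFM_E)
  note translation = MOST_translation_of_reflections[OF MOST_reflection_2 MOST_reflection_2, OF basis _ basis]
  show thesis
    using translation[OF x y(1)] translation[OF y(1) x] y(2)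
    by (intro that[of "x - y"]) (simp_all add: algebra_simps)
qed

lemma essential_element_not_translated:
  fixes A :: "'a::ab_group_add set"
  assumes inf: "infinite (UNIV :: 'a set)" and basis: "hfold_sum 2 A \<sim>\<^sub>f UNIV"
    and \<delta>: "\<delta> \<noteq> 0" "\<forall>\<^sub>\<infinity>c. c \<in> A \<longrightarrow> c - \<delta> \<in> A"
    and a: "a \<in> essential_elements 3 A"
  shows "a + \<delta> \<notin> A"
proof
  assume "a + \<delta> \<in> A"
  have "\<exists>v. v \<notin> hfold_sum 3 (A - {a})"
    using a unfolding essential_elements_def almost_eq_UNIV_iff_MOST by (blast intro: ALL_MOST)
  then obtain v where v: "v \<notin> hfold_sum 3 (A - {a})" ..
  have "\<forall>\<^sub>\<infinity>c. c \<in> A \<longrightarrow> c - \<delta> \<in> A \<and> v - a - c \<in> A \<and> c \<noteq> a + \<delta> \<and> c \<noteq> v - a - a"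
    using \<delta>(2) MOST_reflection_2[OF basis v] MOST_neq(1)[of "a + \<delta>"] MOST_neq(1)[of "v - a - a"]
    by eventually_elim blast
  then obtain c where "c \<in> A"
    and c: "c - \<delta> \<in> A" "v - a - c \<in> A" "c \<noteq> a + \<delta>" "c \<noteq> v - a - a"
    using infinite_imp_ex_MOST[OF infinite_of_hfold_sum_almost_UNIV[OF inf basis]] by blast
  have "a + \<delta> \<in> A - {a}" "c - \<delta> \<in> A - {a}" "v - a - c \<in> A - {a}"
    using \<open>a + \<delta> \<in> A\<close> \<open>\<delta> \<noteq> 0\<close> c by (auto simp: algebra_simps)
  then have "(a + \<delta>) + ((c - \<delta>) + (v - a - c)) \<in> hfold_sum 3 (A - {a})"
    unfolding numeral_3_eq_3 hfold_sum_Suc hfold_sum_0 set_add_0_right by blast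
  with v show False by simp
qed

lemma finite_essential_elements_3:
  fixes A :: "'a::ab_group_add set"
  assumes inf: "infinite (UNIV :: 'a set)" and basis: "hfold_sum 2 A \<sim>\<^sub>f UNIV"
  shows "finite (essential_elements 3 A)"
proof (cases "essential_elements 3 A = {}")
  case False
  then obtain a where "\<not> hfold_sum 3 (A - {a}) \<sim>\<^sub>f UNIV"
    by (auto simp: essential_elements_def)
  then obtain \<delta> where "\<delta> \<noteq> 0" and plus: "\<forall>\<^sub>\<infinity>c. c \<in> A \<longrightarrow> c + \<delta> \<in> A"
    and "\<forall>\<^sub>\<infinity>c. c \<in> A \<longrightarrow> c - \<delta> \<in> A"
    using almost_invariant_translation_exists[OF basis] by blast
  then have "essential_elements 3 A \<subseteq> {c. \<not> (c \<in> A \<longrightarrow> c + \<delta> \<in> A)}"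
    using essential_element_not_translated[OF inf basis] by (auto simp: essential_elements_def)
  with plus show ?thesis
    unfolding MOST_iff_cofinite by (rule rev_finite_subset)
qed simp


section \<open>Dissociated sets\<close>

definition nat_multiple :: "nat \<Rightarrow> 'a::comm_monoid_add \<Rightarrow> 'a" where
  "nat_multiple n x = \<Sum>\<^sub># (replicate_mset n x)"

lemma nat_multiple_simps [simp]:
  "nat_multiple 0 x = 0" "nat_multiple (Suc n) x = x + nat_multiple n x"
  by (simp_all add: nat_multiple_def)

lemma nat_multiple_add: "nat_multiple (m + n) x = nat_multiple m x + nat_multiple n x"
  by (induction m) (simp_all add: add.assoc)

lemma sum_mset_split_element:
  fixes x :: "'a::comm_monoid_add"
  shows "\<Sum>\<^sub># M = nat_multiple (count M x) x + \<Sum>\<^sub># {#y \<in># M. y \<noteq> x#}"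
proof -
  have "M = replicate_mset (count M x) x + {#y \<in># M. y \<noteq> x#}"
    using multiset_partition[of M "\<lambda>y. y = x"] by (simp add: filter_eq_replicate_mset)
  then show ?thesis
    unfolding nat_multiple_def by (metis sum_mset.union)
qed

definition bounded_msets :: "nat \<Rightarrow> 'a set \<Rightarrow> 'a multiset set" where
  "bounded_msets k D = {M. set_mset M \<subseteq> D \<and> (\<forall>x. count M x \<le> k)}"

definition bounded_differences :: "nat \<Rightarrow> 'a::ab_group_add set \<Rightarrow> 'a set" where
  "bounded_differences k D = {\<Sum>\<^sub># M - \<Sum>\<^sub># N | M N. M \<in> bounded_msets k D \<and> N \<in> bounded_msets k D}"

definition dissociated :: "nat \<Rightarrow> 'a::ab_group_add set \<Rightarrow> 'a set \<Rightarrow> bool" where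
  "dissociated k H D \<longleftrightarrow>
    (\<forall>M\<in>bounded_msets k D. \<forall>N\<in>bounded_msets k D. \<Sum>\<^sub># M - \<Sum>\<^sub># N \<in> H \<longrightarrow>
      (\<forall>x. nat_multiple (count M x) x = nat_multiple (count N x) x))"

lemma empty_in_bounded_msets [simp]: "{#} \<in> bounded_msets k D"
  by (simp add: bounded_msets_def)

lemma add_mset_in_bounded_msets_iff [simp]:
  "add_mset x M \<in> bounded_msets k D \<longleftrightarrow> x \<in> D \<and> count M x < k \<and> M \<in> bounded_msets k D"
proof -
  have "(\<forall>y. count (add_mset x M) y \<le> k) \<longleftrightarrow> count M x < k \<and> (\<forall>y. count M y \<le> k)"
    by (metis Suc_le_eq count_add_mset less_imp_le)
  then show ?thesis
    unfolding bounded_msets_def mem_Collect_eq set_mset_add_mset_insert insert_subset by blast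
qed

lemma finite_bounded_msets:
  assumes "finite D"
  shows "finite (bounded_msets k D)"
proof (rule finite_imageD)
  have "count ` bounded_msets k D \<subseteq> {f. \<forall>x. (x \<in> D \<longrightarrow> f x \<in> {..k}) \<and> (x \<notin> D \<longrightarrow> f x = 0)}"
    by (auto simp: bounded_msets_def count_eq_zero_iff)
  then show "finite (count ` bounded_msets k D)"
    by (rule finite_subset) (intro finite_set_of_finite_funs assms finite_atMost)
  show "inj_on count (bounded_msets k D)"
    by (simp add: inj_on_def count_inject)
qed

lemma finite_bounded_differences: "finite D \<Longrightarrow> finite (bounded_differences k D)"
  unfolding bounded_differences_def
  by (rule finite_image_set2[where P = "\<lambda>M. M \<in> bounded_msets k D"]) (simp_all add: finite_bounded_msets)

lemma dissociated_empty: "dissociated k H {}"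
  by (auto simp: dissociated_def bounded_msets_def)

lemma dissociated_mono: "dissociated k H D \<Longrightarrow> C \<subseteq> D \<Longrightarrow> dissociated k H C"
  by (force simp: dissociated_def bounded_msets_def)

lemma filter_in_bounded_msets:
  "M \<in> bounded_msets k (insert d D) \<Longrightarrow> {#x \<in># M. x \<noteq> d#} \<in> bounded_msets k D"
  by (auto simp: bounded_msets_def)

lemma nat_multiple_count_eq_if_le:
  fixes D H :: "'a::ab_group_add set"
  assumes d: "\<And>j. 0 < j \<Longrightarrow> j \<le> k \<Longrightarrow>
      nat_multiple j d = 0 \<or> nat_multiple j d \<notin> H + bounded_differences k D"
    and M: "M \<in> bounded_msets k (insert d D)" and N: "N \<in> bounded_msets k (insert d D)"
    and MN: "\<Sum>\<^sub># M - \<Sum>\<^sub># N \<in> H" "count N d \<le> count M d"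
  shows "nat_multiple (count M d) d = nat_multiple (count N d) d"
proof -
  define j where "j = count M d - count N d"
  have M_d: "nat_multiple (count M d) d = nat_multiple j d + nat_multiple (count N d) d"
    using MN(2) by (simp add: j_def flip: nat_multiple_add)
  then have "nat_multiple j d =
      (\<Sum>\<^sub># M - \<Sum>\<^sub># N) + (\<Sum>\<^sub># {#x \<in># N. x \<noteq> d#} - \<Sum>\<^sub># {#x \<in># M. x \<noteq> d#})"
    by (simp add: sum_mset_split_element[of M d] sum_mset_split_element[of N d])
  also have "\<dots> \<in> H + bounded_differences k D"
    unfolding bounded_differences_def
    using MN(1) filter_in_bounded_msets[OF M] filter_in_bounded_msets[OF N] by blast
  finally have j_d: "nat_multiple j d \<in> H + bounded_differences k D" .
  have "count M d \<le> k"
    using M by (simp add: bounded_msets_def)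
  then have "j \<le> k" by (simp add: j_def)
  then have "nat_multiple j d = 0"
    using d[of j] j_d by (cases "j = 0") auto
  with M_d show ?thesis by simp
qed

lemma dissociated_insert:
  fixes D H :: "'a::ab_group_add set"
  assumes D: "dissociated k H D" and H: "\<And>h. h \<in> H \<Longrightarrow> - h \<in> H"
    and d: "\<And>j. 0 < j \<Longrightarrow> j \<le> k \<Longrightarrow>
      nat_multiple j d = 0 \<or> nat_multiple j d \<notin> H + bounded_differences k D"
  shows "dissociated k H (insert d D)"
  unfolding dissociated_def
proof (intro ballI impI allI)
  fix M N x
  assume M: "M \<in> bounded_msets k (insert d D)" and N: "N \<in> bounded_msets k (insert d D)"
    and MN: "\<Sum>\<^sub># M - \<Sum>\<^sub># N \<in> H"
  have "\<Sum>\<^sub># N - \<Sum>\<^sub># M \<in> H"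
    using H[OF MN] by simp
  then have eq_at_d: "nat_multiple (count M d) d = nat_multiple (count N d) d"
    using nat_multiple_count_eq_if_le[OF d M N MN] nat_multiple_count_eq_if_le[OF d N M]
    by (cases "count N d \<le> count M d") auto
  then have "\<Sum>\<^sub># {#x \<in># M. x \<noteq> d#} - \<Sum>\<^sub># {#x \<in># N. x \<noteq> d#} \<in> H"
    using MN by (simp add: sum_mset_split_element[of M d] sum_mset_split_element[of N d])
  then have "nat_multiple (count {#x \<in># M. x \<noteq> d#} x) x = nat_multiple (count {#x \<in># N. x \<noteq> d#} x) x"
    using D filter_in_bounded_msets[OF M] filter_in_bounded_msets[OF N]
    unfolding dissociated_def by blast
  with eq_at_d show "nat_multiple (count M x) x = nat_multiple (count N x) x"
    by (cases "x = d") simp_all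
qed

lemma dissociated_Union_chain:
  assumes "subset.chain \<A> \<C>" "\<C> \<noteq> {}" and "\<And>D. D \<in> \<C> \<Longrightarrow> dissociated k H D"
  shows "dissociated k H (\<Union>\<C>)"
  unfolding dissociated_def
proof (intro ballI impI allI)
  fix M N x
  assume MN: "M \<in> bounded_msets k (\<Union>\<C>)" "N \<in> bounded_msets k (\<Union>\<C>)" "\<Sum>\<^sub># M - \<Sum>\<^sub># N \<in> H"
  then have "set_mset M \<union> set_mset N \<subseteq> \<Union>\<C>"
    by (simp add: bounded_msets_def)
  then obtain D where "D \<in> \<C>" "set_mset M \<union> set_mset N \<subseteq> D"
    using finite_subset_Union_chain[OF _ _ assms(2,1)] by (metis finite_UnI finite_set_mset)
  with MN have "M \<in> bounded_msets k D" "N \<in> bounded_msets k D" "dissociated k H D"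
    by (simp_all add: bounded_msets_def assms(3))
  with MN(3) show "nat_multiple (count M x) x = nat_multiple (count N x) x"
    unfolding dissociated_def by blast
qed

lemma dissociated_extension_exists:
  fixes S D H :: "'a::ab_group_add set"
  assumes S: "infinite S" and H: "finite H" "\<And>h. h \<in> H \<Longrightarrow> - h \<in> H"
    and multiples: "\<And>j. 0 < j \<Longrightarrow> j \<le> k \<Longrightarrow>
      (\<forall>s\<in>S. nat_multiple j s = 0) \<or> inj_on (nat_multiple j) S"
    and D: "finite D" "dissociated k H D"
  shows "\<exists>d\<in>S - D. dissociated k H (insert d D)"
proof -
  define F where "F = H + bounded_differences k D"
  have "finite F"
    unfolding F_def by (intro finite_set_plus H finite_bounded_differences D)
  define bad where "bad j = {s \<in> S. nat_multiple j s \<noteq> 0 \<and> nat_multiple j s \<in> F}" for j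
  have "finite (bad j)" if "j \<in> {1..k}" for j
  proof (cases "\<forall>s\<in>S. nat_multiple j s = 0")
    case True
    then have "bad j = {}" by (auto simp: bad_def)
    then show ?thesis by simp
  next
    case False
    then have "inj_on (nat_multiple j) S"
      using multiples[of j] that by auto
    with \<open>finite F\<close> have "finite (nat_multiple j -` F \<inter> S)"
      by (rule finite_vimage_IntI)
    then show ?thesis
      by (rule rev_finite_subset) (auto simp: bad_def)
  qed
  then have "finite (D \<union> (\<Union>j\<in>{1..k}. bad j))"
    using D by blast
  then have "infinite (S - (D \<union> (\<Union>j\<in>{1..k}. bad j)))"
    using S by (rule Diff_infinite_finite)
  then obtain d where d: "d \<in> S" "d \<notin> D \<union> (\<Union>j\<in>{1..k}. bad j)"
    by (metis DiffE ex_in_conv finite.emptyI)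
  have "dissociated k H (insert d D)"
  proof (rule dissociated_insert[OF D(2) H(2)])
    fix j :: nat assume "0 < j" "j \<le> k"
    then have "d \<notin> bad j" using d by auto
    then show "nat_multiple j d = 0 \<or> nat_multiple j d \<notin> H + bounded_differences k D"
      using d by (auto simp: bad_def F_def)
  qed
  with d show ?thesis by blast
qed

lemma infinite_dissociated_subset:
  fixes S H :: "'a::ab_group_add set"
  assumes "infinite S" and "finite H" and "\<And>h. h \<in> H \<Longrightarrow> - h \<in> H"
    and "\<And>j. 0 < j \<Longrightarrow> j \<le> k \<Longrightarrow>
      (\<forall>s\<in>S. nat_multiple j s = 0) \<or> inj_on (nat_multiple j) S"
  obtains D where "D \<subseteq> S" "infinite D" "dissociated k H D"
proof -
  define \<A> where "\<A> = {D. D \<subseteq> S \<and> dissociated k H D}"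
  have "\<exists>D\<in>\<A>. \<forall>E\<in>\<A>. D \<subseteq> E \<longrightarrow> E = D"
  proof (rule subset_Zorn_nonempty)
    show "\<A> \<noteq> {}"
      using dissociated_empty by (auto simp: \<A>_def)
    show "\<Union>\<C> \<in> \<A>" if \<C>: "\<C> \<noteq> {}" "subset.chain \<A> \<C>" for \<C>
    proof -
      have "D \<subseteq> S" "dissociated k H D" if "D \<in> \<C>" for D
        using \<C>(2) that by (auto simp: \<A>_def subset.chain_def)
      with dissociated_Union_chain[OF \<C>(2,1)] show ?thesis
        unfolding \<A>_def by blast
    qed
  qed
  then obtain D where "D \<in> \<A>" and maximal: "\<forall>E\<in>\<A>. D \<subseteq> E \<longrightarrow> E = D" ..
  then have D: "D \<subseteq> S" "dissociated k H D"
    by (simp_all add: \<A>_def)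
  have "infinite D"
  proof
    assume "finite D"
    then obtain d where d: "d \<in> S - D" "dissociated k H (insert d D)"
      using dissociated_extension_exists[OF assms \<open>finite D\<close> D(2)] by blast
    then have "insert d D \<in> \<A>"
      using D(1) by (simp add: \<A>_def)
    with maximal have "insert d D = D" by blast
    with d(1) show False by blast
  qed
  with D that show thesis by blast
qed

lemma infinite_set_uniform_doubling:
  assumes inf: "infinite (UNIV :: 'a::ab_group_add set)"
  obtains S :: "'a::ab_group_add set" where "infinite S" "0 \<notin> S"
    "finite (range (\<lambda>x :: 'a::ab_group_add. x + x)) \<and> (\<forall>s\<in>S. s + s = 0) \<or>
      inj_on (\<lambda>x. x + x) S \<and> (\<forall>s\<in>S. s + s \<noteq> 0)"
proof (cases "finite (range (\<lambda>x :: 'a::ab_group_add. x + x))")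
  case True
  then obtain a :: 'a where a: "infinite {x. x + x = a + a}"
    using pigeonhole_infinite[OF inf True] by auto
  have "inj_on (\<lambda>x. x - a) {x. x + x = a + a}"
    by (auto intro: inj_onI)
  with a have "infinite ((\<lambda>x. x - a) ` {x. x + x = a + a})"
    using finite_imageD by blast
  moreover have "(\<lambda>x. x - a) ` {x. x + x = a + a} \<subseteq> {x. x + x = 0}"
    by (auto simp: algebra_simps)
  ultimately have "infinite ({x :: 'a. x + x = 0} - {0})"
    by (metis finite_Diff_insert Diff_empty finite_subset)
  with True show thesis by (intro that[of "{x. x + x = 0} - {0}"]) auto
next
  case False
  define half where "half = inv (\<lambda>x :: 'a. x + x)"
  define Y where "Y = range (\<lambda>x :: 'a. x + x) - {0}"
  have half: "half y + half y = y" if "y \<in> Y" for y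
    using that f_inv_into_f[of y "\<lambda>x :: 'a. x + x" UNIV] by (simp add: Y_def half_def)
  have "infinite Y" using False by (simp add: Y_def)
  moreover have "inj_on half Y" by (metis half inj_onI)
  ultimately have "infinite (half ` Y)" using finite_imageD by blast
  moreover have "\<forall>s\<in>half ` Y. s + s \<noteq> 0"
    using half by (auto simp: Y_def)
  moreover from this have "0 \<notin> half ` Y" by force
  moreover have "inj_on (\<lambda>x. x + x) (half ` Y)"
    by (intro inj_onI) (auto simp: half)
  ultimately show thesis using that by blast
qed


section \<open>Covering the group while avoiding a set of sums\<close>

definition signed_coset_rel :: "'a::ab_group_add set \<Rightarrow> ('a \<times> 'a) set" where
  "signed_coset_rel K = {(x, y). y - x \<in> K \<or> y + x \<in> K}"

lemma equiv_signed_coset_rel: "equiv UNIV (signed_coset_rel (group_closure S))"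
proof (rule equivI)
  let ?K = "group_closure S"
  show "refl (signed_coset_rel ?K)"
    by (auto simp: refl_on_def signed_coset_rel_def)
  show "sym (signed_coset_rel ?K)"
  proof (rule symI)
    fix x y assume "(x, y) \<in> signed_coset_rel ?K"
    then show "(y, x) \<in> signed_coset_rel ?K"
      using group_closure_minus_iff[of "y - x" S] by (auto simp: signed_coset_rel_def add.commute)
  qed
  show "trans (signed_coset_rel ?K)"
  proof (rule transI)
    fix x y z assume "(x, y) \<in> signed_coset_rel ?K" "(y, z) \<in> signed_coset_rel ?K"
    then consider (diff_diff) "z - y \<in> ?K" "y - x \<in> ?K" | (diff_sum) "z - y \<in> ?K" "y + x \<in> ?K"
      | (sum_diff) "z + y \<in> ?K" "y - x \<in> ?K" | (sum_sum) "z + y \<in> ?K" "y + x \<in> ?K"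
      by (auto simp: signed_coset_rel_def)
    then have "z - x \<in> ?K \<or> z + x \<in> ?K"
    proof cases
      case diff_diff
      then show ?thesis using group_closure_add[of "z - y" S "y - x"] by simp
    next
      case diff_sum
      then show ?thesis using group_closure_add[of "z - y" S "y + x"] by (simp add: algebra_simps)
    next
      case sum_diff
      then show ?thesis using group_closure.diff[of "z + y" S "y - x"] by (simp add: algebra_simps)
    next
      case sum_sum
      then show ?thesis using group_closure.diff[of "z + y" S "y + x"] by simp
    qed
    then show "(x, z) \<in> signed_coset_rel ?K"
      by (simp add: signed_coset_rel_def)
  qed
qed simp

lemma countable_group_closure:
  assumes "countable S"
  shows "countable (group_closure S)"
proof -
  let ?f = "\<lambda>(xs, ys). sum_list xs - sum_list ys"
  have "group_closure S \<subseteq> ?f ` (lists S \<times> lists S)"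
  proof
    fix x assume "x \<in> group_closure S"
    then show "x \<in> ?f ` (lists S \<times> lists S)"
    proof induction
      case (base s)
      then consider (zero) "s = 0" | (generator) "s \<in> S" by blast
      then show ?case
      proof cases
        case zero
        then show ?thesis by (intro image_eqI[of _ _ "([], [])"]) simp_all
      next
        case generator
        then show ?thesis by (intro image_eqI[of _ _ "([s], [])"]) simp_all
      qed
    next
      case (diff s t)
      from diff.IH obtain xs ys xs' ys' where "xs \<in> lists S" "ys \<in> lists S" "xs' \<in> lists S" "ys' \<in> lists S"
        "s = sum_list xs - sum_list ys" "t = sum_list xs' - sum_list ys'"
        by auto
      then show ?case
        by (intro image_eqI[of _ _ "(xs @ ys', ys @ xs')"]) (simp_all add: algebra_simps)
    qed
  qed
  then show ?thesis
    by (rule countable_subset) (intro countable_image countable_SIGMA countable_lists assms)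
qed

lemma countable_signed_coset_class:
  assumes "countable K"
  shows "countable (signed_coset_rel K `` {x})"
proof -
  have "y \<in> (\<lambda>k. k + x) ` K \<union> (\<lambda>k. k - x) ` K" if "y \<in> signed_coset_rel K `` {x}" for y
  proof -
    have "y = (y - x) + x" "y = (y + x) - x" by simp_all
    with that show ?thesis
      unfolding signed_coset_rel_def by blast
  qed
  then have "signed_coset_rel K `` {x} \<subseteq> (\<lambda>k. k + x) ` K \<union> (\<lambda>k. k - x) ` K" by blast
  then show ?thesis
    by (rule countable_subset) (simp add: assms)
qed

lemma signed_coset_class_closed:
  assumes "E \<in> UNIV // signed_coset_rel (group_closure S)" and "x \<in> E" and "x - y \<in> group_closure S"
  shows "y \<in> E"
proof -
  have "(x, y) \<in> signed_coset_rel (group_closure S)"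
    using assms(3) group_closure_minus_iff[of "x - y" S] by (simp add: signed_coset_rel_def)
  then show ?thesis
    using in_quotient_imp_closed[OF equiv_signed_coset_rel assms(1,2)] by blast
qed

lemma signed_coset_class_eqI:
  assumes "E \<in> UNIV // signed_coset_rel (group_closure S)"
    and "F \<in> UNIV // signed_coset_rel (group_closure S)"
    and "x \<in> E" "y \<in> F" "x + y \<in> group_closure S"
  shows "E = F"
proof -
  have "(x, y) \<in> signed_coset_rel (group_closure S)"
    using assms(5) by (simp add: signed_coset_rel_def add.commute)
  then show ?thesis
    using quotient_eqI[OF equiv_signed_coset_rel] assms(1-4) by blast
qed

locale greedy_cover =
  fixes D T X :: "'a::ab_group_add set"
  assumes countable_D: "countable D"
    and T_subset: "T \<subseteq> D"
    and infinite_T: "infinite T"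
    and X_subset: "X \<subseteq> group_closure D"
    and MOST_avoid: "\<And>z. \<forall>\<^sub>\<infinity>t. t \<in> T \<longrightarrow> z - t \<notin> X"
    and MOST_avoid_double: "\<And>z. \<forall>\<^sub>\<infinity>t. t \<in> T \<longrightarrow> (z - t) + (z - t) \<notin> X"
    and MOST_avoid_plus_D: "\<And>z. z \<notin> X \<Longrightarrow> \<forall>\<^sub>\<infinity>t. t \<in> T \<longrightarrow> (\<forall>d\<in>D. z - t + d \<notin> X)"
begin

definition admissible :: "'a set \<Rightarrow> 'a set \<Rightarrow> bool" where
  "admissible M U \<longleftrightarrow> (\<forall>u\<in>U. \<exists>z\<in>M. \<exists>t\<in>T. u = z - t) \<and>
    (\<forall>u\<in>U. \<forall>d\<in>D. u + d \<notin> X) \<and> (\<forall>u\<in>U. \<forall>u'\<in>U. u + u' \<notin> X)"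

lemma admissible_empty: "admissible M {}"
  by (simp add: admissible_def)

lemma admissible_insert_exists:
  assumes U: "admissible M U" "finite U" and z: "z \<in> M" "z \<notin> X"
  shows "\<exists>t\<in>T. admissible M (insert (z - t) U)"
proof -
  have "\<forall>\<^sub>\<infinity>t. \<forall>u\<in>U. t \<in> T \<longrightarrow> (z + u) - t \<notin> X"
    by (intro eventually_ball_finite U ballI MOST_avoid)
  with MOST_avoid_double[of z] MOST_avoid_plus_D[OF z(2)]
  have "\<forall>\<^sub>\<infinity>t. t \<in> T \<longrightarrow> (\<forall>u\<in>U. z - t + u \<notin> X \<and> u + (z - t) \<notin> X) \<and> (z - t) + (z - t) \<notin> X \<and>
      (\<forall>d\<in>D. z - t + d \<notin> X)"
    by eventually_elim (auto simp: algebra_simps)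
  then obtain t where "t \<in> T" and t: "\<forall>u\<in>U. z - t + u \<notin> X \<and> u + (z - t) \<notin> X" "(z - t) + (z - t) \<notin> X"
      "\<forall>d\<in>D. z - t + d \<notin> X"
    using infinite_imp_ex_MOST[OF infinite_T] by blast
  then have "admissible M (insert (z - t) U)"
    using z(1) U(1) unfolding admissible_def by auto
  with \<open>t \<in> T\<close> show ?thesis by blast
qed

lemma admissible_Union_incseq:
  fixes U :: "nat \<Rightarrow> 'a set"
  assumes "incseq U" and "\<And>n. admissible M (U n)"
  shows "admissible M (\<Union>n. U n)"
proof -
  have "u + u' \<notin> X" if "u \<in> U m" "u' \<in> U n" for u u' m n
  proof -
    have "u \<in> U (max m n)" "u' \<in> U (max m n)"
      using that incseqD[OF assms(1)] by (meson max.cobounded1 max.cobounded2 subsetD)+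
    then show ?thesis
      using assms(2)[of "max m n"] by (auto simp: admissible_def)
  qed
  then show ?thesis
    using assms(2) unfolding admissible_def by blast
qed

lemma admissible_chain_exists:
  fixes z :: "nat \<Rightarrow> 'a"
  assumes "range z \<subseteq> M - X"
  obtains U where "incseq U" "\<And>n. admissible M (U n)" "\<And>n. z n \<in> U (Suc n) + T"
proof -
  have "\<exists>U. \<forall>n. (admissible M (U n) \<and> finite (U n)) \<and> (U n \<subseteq> U (Suc n) \<and> z n \<in> U (Suc n) + T)"
  proof (rule dependent_nat_choice)
    show "\<exists>U. admissible M U \<and> finite U"
      using admissible_empty by blast
    show "\<exists>V. (admissible M V \<and> finite V) \<and> (U \<subseteq> V \<and> z n \<in> V + T)"
      if U: "admissible M U \<and> finite U" for U n
    proof -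
      have "z n \<in> M" "z n \<notin> X"
        using assms by auto
      then obtain t where "t \<in> T" "admissible M (insert (z n - t) U)"
        using admissible_insert_exists U by blast
      moreover have "z n \<in> insert (z n - t) U + T"
        using set_plus_intro[of "z n - t" "insert (z n - t) U" t T] \<open>t \<in> T\<close> by simp
      ultimately show ?thesis
        using U by (intro exI[of _ "insert (z n - t) U"]) auto
    qed
  qed
  then show thesis
    using that incseq_SucI by blast
qed

lemma admissible_cover_of_countable:
  assumes "countable M"
  obtains U where "admissible M U" "M - X \<subseteq> U + T"
proof (cases "M - X = {}")
  case True
  then show thesis using that admissible_empty by blast
next
  case False
  define z where "z = from_nat_into (M - X)"
  have range_z: "range z = M - X"
    unfolding z_def using False assms by (intro range_from_nat_into countable_Diff)
  then obtain U where U: "incseq U" "\<And>n. admissible M (U n)" "\<And>n. z n \<in> U (Suc n) + T"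
    using admissible_chain_exists[of z M] by auto
  have "M - X \<subseteq> (\<Union>n. U n) + T"
  proof
    fix y assume "y \<in> M - X"
    then obtain n where "y = z n"
      unfolding range_z[symmetric] by blast
    then show "y \<in> (\<Union>n. U n) + T"
      using U(3)[of n] set_plus_mono2[of "U (Suc n)" "\<Union>n. U n" T T] by blast
  qed
  with admissible_Union_incseq[OF U(1,2)] show thesis by (rule that)
qed

lemma admissible_class_cover_exists:
  assumes "E \<in> UNIV // signed_coset_rel (group_closure D)"
  shows "\<exists>U. admissible E U \<and> U \<subseteq> E \<and> E - X \<subseteq> U + T"
proof -
  have "countable E"
    using assms countable_D
    by (auto simp: quotient_def intro: countable_signed_coset_class countable_group_closure)
  then obtain U where U: "admissible E U" "E - X \<subseteq> U + T"
    by (rule admissible_cover_of_countable)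
  have "u \<in> E" if u: "u \<in> U" for u
  proof -
    obtain x t where "x \<in> E" "t \<in> T" "u = x - t"
      using U(1) u unfolding admissible_def by blast
    then show ?thesis
      using signed_coset_class_closed[OF assms, of x u] T_subset by (auto intro: group_closure.base)
  qed
  with U show ?thesis by blast
qed

lemma cover_exists:
  obtains U where "- X \<subseteq> U + T" "\<And>u d. u \<in> U \<Longrightarrow> d \<in> D \<Longrightarrow> u + d \<notin> X"
    "\<And>u u'. u \<in> U \<Longrightarrow> u' \<in> U \<Longrightarrow> u + u' \<notin> X"
proof -
  define \<E> where "\<E> = UNIV // signed_coset_rel (group_closure D)"
  have "\<forall>E\<in>\<E>. \<exists>U. admissible E U \<and> U \<subseteq> E \<and> E - X \<subseteq> U + T"
    unfolding \<E>_def using admissible_class_cover_exists by blast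
  from bchoice[OF this] obtain f
    where "\<forall>E\<in>\<E>. admissible E (f E) \<and> f E \<subseteq> E \<and> E - X \<subseteq> f E + T" ..
  then have f: "admissible E (f E)" "f E \<subseteq> E" "E - X \<subseteq> f E + T" if "E \<in> \<E>" for E
    using that by blast+
  define U where "U = (\<Union>E\<in>\<E>. f E)"
  show thesis
  proof (rule that)
    show "- X \<subseteq> U + T"
    proof
      fix z assume "z \<in> - X"
      have "z \<in> \<Union>\<E>"
        unfolding \<E>_def Union_quotient[OF equiv_signed_coset_rel] by (rule UNIV_I)
      then obtain E where "E \<in> \<E>" "z \<in> E" by blast
      then have "z \<in> f E + T" "f E \<subseteq> U"
        using f(3) \<open>z \<in> - X\<close> unfolding U_def by blast+
      then show "z \<in> U + T"
        using set_plus_mono2[of "f E" U T T] by blast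
    qed
    show "u + d \<notin> X" if "u \<in> U" "d \<in> D" for u d
      using f(1) that unfolding U_def admissible_def by blast
    show "u + u' \<notin> X" if uu': "u \<in> U" "u' \<in> U" for u u'
    proof
      assume sum: "u + u' \<in> X"
      obtain E E' where E: "E \<in> \<E>" "E' \<in> \<E>" "u \<in> f E" "u' \<in> f E'"
        using uu' unfolding U_def by blast
      have "E = E'"
      proof (rule signed_coset_class_eqI)
        show "u \<in> E" "u' \<in> E'" using f(2) E by blast+
        show "u + u' \<in> group_closure D" using sum X_subset by blast
      qed (use E in \<open>simp_all add: \<E>_def\<close>)
      with sum E f(1)[OF E(1)] show False
        unfolding admissible_def by blast
    qed
  qed
qed

end


section \<open>A basis with infinitely many essential elements\<close>

text \<open>
  The assumption on doubles serves to exclude \<open>(z - t) + (z - t) \<in> P + Q\<close> for almost all \<open>t \<in> T\<close>. If there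
  are only finitely many elements \<open>x + x\<close>, then \<open>t + t\<close> cannot help; instead, \<open>H\<close> contains all of them but
  no \<open>p + q\<close> with \<open>p \<in> P\<close> and \<open>q \<in> Q\<close>.
\<close>

locale dissociated_triple =
  fixes H P Q T :: "'a::ab_group_add set"
  assumes dissociated: "dissociated 2 H (P \<union> Q \<union> T)"
    and zero_mem_H: "0 \<in> H"
    and zero_not_mem: "0 \<notin> P \<union> Q \<union> T"
    and doubles: "range (\<lambda>x. x + x) \<subseteq> H \<or> (\<forall>t\<in>T. t + t \<noteq> 0)"
    and disjoint: "P \<inter> Q = {}" "P \<inter> T = {}" "Q \<inter> T = {}"
    and infinite: "infinite P" "infinite Q" "infinite T"
    and countable: "countable (P \<union> Q \<union> T)"
begin

abbreviation D :: "'a set" where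
  "D \<equiv> P \<union> Q \<union> T"

lemma nat_multiple_count_eq_0:
  assumes "M \<in> bounded_msets 2 D" "N \<in> bounded_msets 2 D" "\<Sum>\<^sub># M - \<Sum>\<^sub># N \<in> H" "x \<notin># N"
  shows "nat_multiple (count M x) x = 0"
proof -
  have "nat_multiple (count M x) x = nat_multiple (count N x) x"
    using dissociated assms(1-3) unfolding dissociated_def by blast
  with \<open>x \<notin># N\<close> show ?thesis
    by (simp add: not_in_iff)
qed

lemma count_neq_1:
  assumes "M \<in> bounded_msets 2 D" "N \<in> bounded_msets 2 D" "\<Sum>\<^sub># M - \<Sum>\<^sub># N \<in> H" "x \<in> D" "x \<notin># N"
  shows "count M x \<noteq> 1"
  using nat_multiple_count_eq_0[OF assms(1-3,5)] \<open>x \<in> D\<close> zero_not_mem by auto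

lemma P_summand_determined:
  assumes "p \<in> P" "q \<in> Q" "d \<in> D" "d' \<in> D" "p + q = d + d'"
  shows "p = d \<or> p = d'"
proof (rule ccontr)
  assume p: "\<not> (p = d \<or> p = d')"
  have "p \<noteq> q" using assms disjoint by blast
  then have "{#p, q#} \<in> bounded_msets 2 D" "{#d, d'#} \<in> bounded_msets 2 D" "count {#p, q#} p = 1"
    using assms by auto
  then show False
    using count_neq_1[of "{#p, q#}" "{#d, d'#}" p] p assms zero_mem_H by simp
qed

lemma T_summand_determined:
  assumes pqt: "p \<in> P" "q \<in> Q" "t \<in> T" and pqt': "p' \<in> P" "q' \<in> Q" "t' \<in> T"
    and d: "d \<in> D" "d' \<in> D" and eq: "d' + (p + q + t) = d + (p' + q' + t')"
  shows "t \<in> {t', d, d'}"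
proof (rule ccontr)
  assume t: "t \<notin> {t', d, d'}"
  have distinct: "p \<noteq> q" "p \<noteq> t" "q \<noteq> t" "p' \<noteq> q'" "p' \<noteq> t'" "q' \<noteq> t'" "p' \<noteq> t" "q' \<noteq> t"
    using pqt pqt' disjoint by blast+
  have "{#d', p, q, t#} \<in> bounded_msets 2 D" "{#d, p', q', t'#} \<in> bounded_msets 2 D"
    using pqt pqt' d distinct by auto
  moreover have "\<Sum>\<^sub># {#d', p, q, t#} - \<Sum>\<^sub># {#d, p', q', t'#} \<in> H"
    using eq zero_mem_H by (simp add: add.assoc)
  moreover have "t \<in> D" "t \<notin># {#d, p', q', t'#}"
    using pqt distinct t by simp_all
  ultimately have "count {#d', p, q, t#} t \<noteq> 1"
    by (rule count_neq_1)
  then show False using distinct t by auto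
qed

lemma MOST_diff_notin: "\<forall>\<^sub>\<infinity>t. t \<in> T \<longrightarrow> z - t \<notin> P + Q"
proof (rule MOST_avoidI)
  fix t' assume t': "t' \<in> T" "z - t' \<in> P + Q"
  from t'(2) obtain p' q' where pq': "z - t' = p' + q'" "p' \<in> P" "q' \<in> Q"
    by (rule set_plus_elim)
  have "t = t'" if t: "t \<in> T" "z - t \<in> P + Q" for t
  proof -
    obtain p q where pq: "z - t = p + q" "p \<in> P" "q \<in> Q"
      using t(2) by (rule set_plus_elim)
    have "p' + (p + q + t) = p' + (p' + q' + t')"
      by (simp flip: pq(1) pq'(1))
    then have "t \<in> {t', p', p'}"
      using T_summand_determined t(1) t'(1) pq(2,3) pq'(2,3) by blast
    then show ?thesis
      using t(1) pq'(2) disjoint by blast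
  qed
  then show "\<exists>F. finite F \<and> {t \<in> T. z - t \<in> P + Q} \<subseteq> F"
    by (intro exI[of _ "{t'}"]) auto
qed

lemma MOST_double_diff_notin: "\<forall>\<^sub>\<infinity>t. t \<in> T \<longrightarrow> (z - t) + (z - t) \<notin> P + Q"
proof (rule MOST_avoidI)
  fix t' assume t': "t' \<in> T" "(z - t') + (z - t') \<in> P + Q"
  from t'(2) obtain p' q' where pq': "p' \<in> P" "q' \<in> Q" "(z - t') + (z - t') = p' + q'"
    by (auto elim: set_plus_elim)
  have "p' \<noteq> q'" using pq' disjoint by blast
  then have "p' + q' \<notin> H"
    using count_neq_1[of "{#p', q'#}" "{#}" p'] pq' by auto
  then have no_torsion: "\<forall>t\<in>T. t + t \<noteq> 0"
    using doubles pq'(3) by (metis rangeI subsetD)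
  have "t = t'" if t: "t \<in> T" "(z - t) + (z - t) \<in> P + Q" for t
  proof (rule ccontr)
    assume "t \<noteq> t'"
    obtain p q where pq: "p \<in> P" "q \<in> Q" "(z - t) + (z - t) = p + q"
      using t(2) by (auto elim: set_plus_elim)
    have distinct: "p \<noteq> q" "p \<noteq> t" "q \<noteq> t" "p' \<noteq> t'" "q' \<noteq> t'" "p' \<noteq> t" "q' \<noteq> t"
      using pq pq' t t' disjoint by blast+
    have "{#p, q, t, t#} \<in> bounded_msets 2 D" "{#p', q', t', t'#} \<in> bounded_msets 2 D"
      using pq pq' t t' distinct \<open>p' \<noteq> q'\<close> by auto
    moreover have "\<Sum>\<^sub># {#p, q, t, t#} - \<Sum>\<^sub># {#p', q', t', t'#} \<in> H"
      using pq(3) pq'(3) zero_mem_H by (simp add: algebra_simps)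
    moreover have "t \<notin># {#p', q', t', t'#}"
      using distinct \<open>t \<noteq> t'\<close> by simp
    ultimately have "nat_multiple (count {#p, q, t, t#} t) t = 0"
      by (rule nat_multiple_count_eq_0)
    then show False
      using no_torsion t distinct by simp
  qed
  then show "\<exists>F. finite F \<and> {t \<in> T. (z - t) + (z - t) \<in> P + Q} \<subseteq> F"
    by (intro exI[of _ "{t'}"]) auto
qed

lemma MOST_diff_plus_notin:
  assumes "z \<notin> P + Q"
  shows "\<forall>\<^sub>\<infinity>t. t \<in> T \<longrightarrow> \<not> (\<exists>d\<in>D. z - t + d \<in> P + Q)"
proof (rule MOST_avoidI)
  fix t' assume t': "t' \<in> T" "\<exists>d\<in>D. z - t' + d \<in> P + Q"
  from t'(2) obtain p' q' d' where pq': "z - t' + d' = p' + q'" "p' \<in> P" "q' \<in> Q" and "d' \<in> D"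
    by (blast elim: set_plus_elim)
  have "t \<in> {t', d'}" if t: "t \<in> T" "\<exists>d\<in>D. z - t + d \<in> P + Q" for t
  proof -
    obtain p q d where pq: "z - t + d = p + q" "p \<in> P" "q \<in> Q" and "d \<in> D"
      using t(2) by (blast elim: set_plus_elim)
    have eq: "d' + (p + q + t) = d + (p' + q' + t')"
      by (simp flip: pq(1) pq'(1) add: algebra_simps)
    have "t \<in> {t', d, d'}"
      by (rule T_summand_determined[OF pq(2,3) t(1) pq'(2,3) t'(1) \<open>d \<in> D\<close> \<open>d' \<in> D\<close> eq])
    moreover have "t \<noteq> d"
      using assms pq by auto
    ultimately show ?thesis by blast
  qed
  then show "\<exists>F. finite F \<and> {t \<in> T. \<exists>d\<in>D. z - t + d \<in> P + Q} \<subseteq> F"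
    by (intro exI[of _ "{t', d'}"]) auto
qed

lemma greedy_cover_sumset: "greedy_cover D T (P + Q)"
proof
  show "P + Q \<subseteq> group_closure D"
  proof
    fix x assume "x \<in> P + Q"
    then obtain p q where "x = p + q" "p \<in> P" "q \<in> Q" by (rule set_plus_elim)
    then show "x \<in> group_closure D"
      by (simp add: group_closure_add group_closure.base)
  qed
  show "\<forall>\<^sub>\<infinity>t. t \<in> T \<longrightarrow> (\<forall>d\<in>D. z - t + d \<notin> P + Q)" if "z \<notin> P + Q" for z
    using MOST_diff_plus_notin[OF that] by simp
qed (use countable infinite MOST_diff_notin MOST_double_diff_notin in auto)

lemma basis_with_essential_P:
  obtains A where "hfold_sum 2 A = UNIV" "P \<subseteq> essential_elements 2 A"
proof -
  obtain U where cover: "- (P + Q) \<subseteq> U + T"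
    and UD: "\<And>u d. u \<in> U \<Longrightarrow> d \<in> D \<Longrightarrow> u + d \<notin> P + Q"
    and UU: "\<And>u u'. u \<in> U \<Longrightarrow> u' \<in> U \<Longrightarrow> u + u' \<notin> P + Q"
    using greedy_cover.cover_exists[OF greedy_cover_sumset] by blast
  define A where "A = D \<union> U"
  have "P + Q \<subseteq> A + A" "U + T \<subseteq> A + A"
    unfolding A_def by (rule set_plus_mono2; blast)+
  with cover have "hfold_sum 2 A = UNIV"
    unfolding hfold_sum_2 by blast
  moreover have "p \<in> essential_elements 2 A" if "p \<in> P" for p
  proof -
    have "p + q \<notin> hfold_sum 2 (A - {p})" if "q \<in> Q" for q
    proof
      assume "p + q \<in> hfold_sum 2 (A - {p})"
      then obtain b b' where b: "p + q = b + b'" "b \<in> A - {p}" "b' \<in> A - {p}"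
        unfolding hfold_sum_2 by (rule set_plus_elim)
      have "b + b' \<in> P + Q" "b' + b \<in> P + Q"
        unfolding add.commute[of b' b] b(1)[symmetric]
        using \<open>p \<in> P\<close> \<open>q \<in> Q\<close> by (rule set_plus_intro)+
      then have "b \<in> D" "b' \<in> D"
        using UD UU b(2,3) unfolding A_def by blast+
      then show False
        using P_summand_determined[OF \<open>p \<in> P\<close> \<open>q \<in> Q\<close> _ _ b(1)] b(2,3) by blast
    qed
    then have "(+) p ` Q \<subseteq> - hfold_sum 2 (A - {p})" by blast
    moreover have "infinite ((+) p ` Q)"
      using infinite(2) by (simp add: finite_image_iff)
    ultimately have "infinite (- hfold_sum 2 (A - {p}))"
      using finite_subset by blast
    then show ?thesis
      using \<open>p \<in> P\<close>
      by (auto simp: essential_elements_def A_def almost_eq_UNIV_iff_MOST MOST_iff_cofinite Compl_eq)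
  qed
  ultimately show thesis using that by blast
qed

end

lemma infinite_dissociated_2_exists:
  assumes "infinite (UNIV :: 'a::ab_group_add set)"
  obtains H D :: "'a::ab_group_add set" where "infinite D" "dissociated 2 H D" "0 \<in> H" "0 \<notin> D"
    "range (\<lambda>x. x + x) \<subseteq> H \<or> (\<forall>d\<in>D. d + d \<noteq> 0)"
proof -
  let ?doubles = "range (\<lambda>x :: 'a. x + x)"
  obtain S :: "'a set" where S: "infinite S" "0 \<notin> S"
    "finite ?doubles \<and> (\<forall>s\<in>S. s + s = 0) \<or> inj_on (\<lambda>x. x + x) S \<and> (\<forall>s\<in>S. s + s \<noteq> 0)"
    by (rule infinite_set_uniform_doubling[OF assms])
  define H where "H = (if finite ?doubles then ?doubles else {0})"
  have H: "finite H" "0 \<in> H"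
    by (auto simp: H_def intro: range_eqI[of _ _ 0])
  have uminus_H: "- h \<in> H" if "h \<in> H" for h
    using that by (auto simp: H_def intro: range_eqI[of _ _ "- _"] split: if_splits)
  have multiples: "(\<forall>s\<in>S. nat_multiple j s = 0) \<or> inj_on (nat_multiple j) S" if "0 < j" "j \<le> 2" for j
  proof -
    have "j = 1 \<or> j = 2" using that by linarith
    then show ?thesis
      using S(3) by (auto simp: numeral_2_eq_2 inj_on_def)
  qed
  obtain D where D: "D \<subseteq> S" "infinite D" "dissociated 2 H D"
    by (rule infinite_dissociated_subset[OF S(1) H(1) uminus_H multiples])
  have "?doubles \<subseteq> H \<or> (\<forall>d\<in>D. d + d \<noteq> 0)"
  proof (cases "finite ?doubles")
    case False
    with S(3) D(1) show ?thesis by blast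
  qed (simp add: H_def)
  with D H(2) S(2) show thesis by (intro that[of D H]) auto
qed

lemma dissociated_triple_exists:
  assumes "infinite (UNIV :: 'a::ab_group_add set)"
  obtains H P Q T :: "'a::ab_group_add set" where "dissociated_triple H P Q T"
proof -
  obtain H D :: "'a set" where D: "infinite D" "dissociated 2 H D" "0 \<in> H" "0 \<notin> D"
    "range (\<lambda>x. x + x) \<subseteq> H \<or> (\<forall>d\<in>D. d + d \<noteq> 0)"
    by (rule infinite_dissociated_2_exists[OF assms])
  obtain C where C: "C \<subseteq> D" "countable C" "infinite C"
    using infinite_countable_subset'[OF D(1)] by blast
  obtain B :: "nat \<Rightarrow> 'a set" where B: "pairwise (\<lambda>i j. disjnt (B i) (B j)) UNIV"
    "(\<Union>i. B i) \<subseteq> C" "\<And>i. infinite (B i)"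
    using infinite_infinite_partition[OF C(3)] by blast
  have B_subset: "B 0 \<union> B 1 \<union> B 2 \<subseteq> C" using B(2) by blast
  have "dissociated_triple H (B 0) (B 1) (B 2)"
  proof
    show "dissociated 2 H (B 0 \<union> B 1 \<union> B 2)"
      using dissociated_mono[OF D(2)] B_subset C(1) by blast
    show "0 \<notin> B 0 \<union> B 1 \<union> B 2"
      using B_subset C(1) D(4) by blast
    show "range (\<lambda>x. x + x) \<subseteq> H \<or> (\<forall>t\<in>B 2. t + t \<noteq> 0)"
      using D(5) B_subset C(1) by blast
    show "B 0 \<inter> B 1 = {}" "B 0 \<inter> B 2 = {}" "B 1 \<inter> B 2 = {}"
      using B(1) by (simp_all add: pairwise_def disjnt_def)
    show "countable (B 0 \<union> B 1 \<union> B 2)"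
      using B_subset C(2) by (rule countable_subset)
  qed (fact B(3) D(3))+
  then show thesis by (rule that)
qed

lemma infinite_essential_elements_2:
  assumes "infinite (UNIV :: 'a::ab_group_add set)"
  shows "\<exists>A :: 'a set. hfold_sum 2 A = UNIV \<and> infinite (essential_elements 2 A)"
proof -
  obtain H P Q T :: "'a set" where triple: "dissociated_triple H P Q T"
    using dissociated_triple_exists[OF assms] .
  obtain A where "hfold_sum 2 A = UNIV" "P \<subseteq> essential_elements 2 A"
    using dissociated_triple.basis_with_essential_P[OF triple] .
  moreover have "infinite P"
    using triple by (rule dissociated_triple.infinite)
  ultimately show ?thesis using finite_subset by blast
qed

theorem theorem1p8:
  assumes "infinite (UNIV :: 'a::ab_group_add set)"
  shows "S_fun TYPE('a) 2 = 3"
proof -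
  have "S_fun TYPE('a) 2 \<le> enat 3"
    using S_fun_le_iff[OF assms, of 3 2] finite_essential_elements_3[OF assms] by simp
  moreover have "\<not> S_fun TYPE('a) 2 \<le> enat 2"
  proof -
    obtain A :: "'a set" where "hfold_sum 2 A = UNIV" "infinite (essential_elements 2 A)"
      using infinite_essential_elements_2[OF assms] by blast
    then show ?thesis
      using S_fun_le_iff[OF assms, of 2 2] by (auto simp: almost_eq_def)
  qed
  ultimately show ?thesis
    by (cases "S_fun TYPE('a) 2") (auto simp: numeral_eq_enat)
qed

end
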